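(* Let $\mu=(\mu_1,\dots,\mu_k)$ be a sequence of valuated matroids whose sequence of underlying matroids $M=(M_1,\dots,M_k)$ is a flag matroid. Then the following are equivalent: (1) $\mu$ is a point of the flag Dressian $FlDr(M)$; (2) there exists a sequence of Lorentzian polynomials $f_1,\dots,f_k$, with $f_i$ supported on the set of bases $B_i$ of $M_i$, such that $\operatorname{trop}(f_i)=\mu_i$ for all $i$ and $(\mu_1,\dots,\mu_k)$ is a valuated flag matroid.
   Context: A valuated matroid is an M-convex function $\mu:\mathbb{N}^n\to\mathbb{R}\cup\{\infty\}$ (for all $\alpha,\beta$ with finite values and $i$ with $\alpha_i>\beta_i$ there is $j$ with $\alpha_j<\beta_j$ and $\mu(\alpha)+\mu(\beta)\ge\mu(\alpha-e_i+e_j)+\mu(\beta-e_j+e_i)$) whose finite domain lies in $\{0,1\}^n$; its underlying matroid has as bases the finite domain. A flag matroid is a sequence of matroids $M_1,\dots,M_k$ on $[n]$ with each $M_i$ a quotient of $M_{i+1}$. The flag Dressian $FlDr(M)$ is the tropical prevariety of sequences $(\mu_1,\dots,\mu_k)$ with underlying flag matroid $M$ satisfying the tropical Grassmann–Plücker relations (for each $\mu_i$) and the tropical incidence-Plücker relations (between $\mu_i$ and $\mu_j$); a valuated flag matroid is a sequence of valuated matroids satisfying these relations. Lorentzian polynomials are taken over the field of real convergent Puiseux series in the sense of Brändén–Huh, and $\operatorname{trop}(f)$ is $\alpha\mapsto\operatorname{val}(c_\alpha)$ for $f=\sum c_\alpha x^\alpha$.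
   Formalization: The Lorentzian polynomials are taken over convergent Puiseux series with arbitrary real exponents (finitely many below each bound), not rational exponents of common denominator, since a real-valued valuated matroid with an irrational value is not a tropicalization over the latter. *)

theory Defs
  imports "HOL-Analysis.Analysis" "HOL-Library.Extended_Real"
begin

text \<open>Points of N^n are functions nat => nat vanishing outside {..<n}.
  Extended values R \<union> {\<infinity>} are ereals different from -\<infinity>.\<close>

definition in_Nn :: "nat \<Rightarrow> (nat \<Rightarrow> nat) \<Rightarrow> bool" where
  "in_Nn n \<alpha> \<longleftrightarrow> (\<forall>j. n \<le> j \<longrightarrow> \<alpha> j = 0)"

definition exch :: "(nat \<Rightarrow> nat) \<Rightarrow> nat \<Rightarrow> nat \<Rightarrow> (nat \<Rightarrow> nat)" where
  "exch \<alpha> i j = (\<alpha>(i := \<alpha> i - 1))(j := \<alpha> j + 1)"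

definition ind :: "nat set \<Rightarrow> (nat \<Rightarrow> nat)" where
  "ind B = (\<lambda>x. if x \<in> B then 1 else 0)"

definition M_convex_fun :: "nat \<Rightarrow> ((nat \<Rightarrow> nat) \<Rightarrow> ereal) \<Rightarrow> bool" where
  "M_convex_fun n \<mu> \<longleftrightarrow>
     (\<forall>\<alpha>. \<mu> \<alpha> \<noteq> -\<infinity>) \<and> (\<forall>\<alpha>. \<mu> \<alpha> \<noteq> \<infinity> \<longrightarrow> in_Nn n \<alpha>) \<and>
     (\<forall>\<alpha> \<beta> i. \<mu> \<alpha> \<noteq> \<infinity> \<longrightarrow> \<mu> \<beta> \<noteq> \<infinity> \<longrightarrow> i < n \<longrightarrow> \<alpha> i > \<beta> i \<longrightarrow>
        (\<exists>j<n. \<alpha> j < \<beta> j \<and> \<mu> \<alpha> + \<mu> \<beta> \<ge> \<mu> (exch \<alpha> i j) + \<mu> (exch \<beta> j i)))"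

definition valuated_matroid :: "nat \<Rightarrow> ((nat \<Rightarrow> nat) \<Rightarrow> ereal) \<Rightarrow> bool" where
  "valuated_matroid n \<mu> \<longleftrightarrow> M_convex_fun n \<mu> \<and> (\<exists>\<alpha>. \<mu> \<alpha> \<noteq> \<infinity>) \<and>
     (\<forall>\<alpha>. \<mu> \<alpha> \<noteq> \<infinity> \<longrightarrow> (\<forall>j. \<alpha> j \<le> 1))"

definition underlying :: "nat \<Rightarrow> ((nat \<Rightarrow> nat) \<Rightarrow> ereal) \<Rightarrow> nat set set" where
  "underlying n \<mu> = {B. B \<subseteq> {..<n} \<and> \<mu> (ind B) \<noteq> \<infinity>}"

definition matroid :: "nat \<Rightarrow> nat set set \<Rightarrow> bool" where
  "matroid n Bs \<longleftrightarrow> Bs \<noteq> {} \<and> (\<forall>B\<in>Bs. B \<subseteq> {..<n}) \<and>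
     (\<forall>B1\<in>Bs. \<forall>B2\<in>Bs. \<forall>x\<in>B1 - B2. \<exists>y\<in>B2 - B1. insert y (B1 - {x}) \<in> Bs)"

definition mrank :: "nat set set \<Rightarrow> nat set \<Rightarrow> nat" where
  "mrank Bs A = Max ((\<lambda>B. card (A \<inter> B)) ` Bs)"

definition matroid_rank :: "nat set set \<Rightarrow> nat" where
  "matroid_rank Bs = card (SOME B. B \<in> Bs)"

definition flat :: "nat \<Rightarrow> nat set set \<Rightarrow> nat set \<Rightarrow> bool" where
  "flat n Bs F \<longleftrightarrow> F \<subseteq> {..<n} \<and> (\<forall>x\<in>{..<n} - F. mrank Bs (insert x F) > mrank Bs F)"

definition quotient_of :: "nat \<Rightarrow> nat set set \<Rightarrow> nat set set \<Rightarrow> bool" where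
  "quotient_of n M1 M2 \<longleftrightarrow> (\<forall>F. flat n M1 F \<longrightarrow> flat n M2 F)"

definition flag_matroid :: "nat \<Rightarrow> nat \<Rightarrow> (nat \<Rightarrow> nat set set) \<Rightarrow> bool" where
  "flag_matroid n k M \<longleftrightarrow> (\<forall>i<k. matroid n (M i)) \<and>
     (\<forall>i. i + 1 < k \<longrightarrow> quotient_of n (M i) (M (i + 1)))"

definition min_twice :: "nat set \<Rightarrow> (nat \<Rightarrow> ereal) \<Rightarrow> bool" where
  "min_twice X g \<longleftrightarrow> (\<forall>x\<in>X. g x = \<infinity>) \<or>
     (\<exists>a\<in>X. \<exists>b\<in>X. a \<noteq> b \<and> g a = g b \<and> (\<forall>c\<in>X. g a \<le> g c))"

text \<open>Tropical incidence-Pluecker relations between mu (rank r) and nu (rank s);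
  for mu = nu, r = s these are the tropical Grassmann-Pluecker relations.\<close>
definition trop_plucker ::
  "nat \<Rightarrow> ((nat \<Rightarrow> nat) \<Rightarrow> ereal) \<Rightarrow> ((nat \<Rightarrow> nat) \<Rightarrow> ereal) \<Rightarrow> nat \<Rightarrow> nat \<Rightarrow> bool" where
  "trop_plucker n \<mu> \<nu> r s \<longleftrightarrow>
     (\<forall>I J. I \<subseteq> {..<n} \<longrightarrow> J \<subseteq> {..<n} \<longrightarrow> card I + 1 = r \<longrightarrow> card J = s + 1 \<longrightarrow>
        min_twice (J - I) (\<lambda>x. \<mu> (ind (insert x I)) + \<nu> (ind (J - {x}))))"

definition flag_relations :: "nat \<Rightarrow> nat \<Rightarrow> (nat \<Rightarrow> (nat \<Rightarrow> nat) \<Rightarrow> ereal) \<Rightarrow> bool" where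
  "flag_relations n k \<mu> \<longleftrightarrow>
     (\<forall>i<k. trop_plucker n (\<mu> i) (\<mu> i) (matroid_rank (underlying n (\<mu> i)))
                                      (matroid_rank (underlying n (\<mu> i)))) \<and>
     (\<forall>i j. i < j \<longrightarrow> j < k \<longrightarrow> trop_plucker n (\<mu> i) (\<mu> j) (matroid_rank (underlying n (\<mu> i)))
                                      (matroid_rank (underlying n (\<mu> j))))"

definition FlDr :: "nat \<Rightarrow> nat \<Rightarrow> (nat \<Rightarrow> nat set set) \<Rightarrow> (nat \<Rightarrow> (nat \<Rightarrow> nat) \<Rightarrow> ereal) set" where
  "FlDr n k M = {\<mu>. (\<forall>i<k. (\<forall>\<alpha>. \<mu> i \<alpha> \<noteq> -\<infinity>) \<and> (\<forall>\<alpha>. \<mu> i \<alpha> \<noteq> \<infinity> \<longrightarrow> (\<exists>B. \<alpha> = ind B)) \<and>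
                        underlying n (\<mu> i) = M i) \<and> flag_relations n k \<mu>}"

definition valuated_flag_matroid :: "nat \<Rightarrow> nat \<Rightarrow> (nat \<Rightarrow> (nat \<Rightarrow> nat) \<Rightarrow> ereal) \<Rightarrow> bool" where
  "valuated_flag_matroid n k \<mu> \<longleftrightarrow> (\<forall>i<k. valuated_matroid n (\<mu> i)) \<and> flag_relations n k \<mu>"

text \<open>An element is its coefficient function a : R -> R (a r = coefficient of t^r).
  Support discrete and bounded below (finite below every c), and the series
  converges absolutely for some t = s > 0.\<close>
definition puiseux :: "(real \<Rightarrow> real) \<Rightarrow> bool" where
  "puiseux a \<longleftrightarrow> (\<forall>c. finite {r. a r \<noteq> 0 \<and> r \<le> c}) \<and>
     (\<exists>s>0. ((\<lambda>r. \<bar>a r * s powr r\<bar>) summable_on UNIV))"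

definition kzero :: "real \<Rightarrow> real" where "kzero = (\<lambda>_. 0)"

definition kadd :: "(real \<Rightarrow> real) \<Rightarrow> (real \<Rightarrow> real) \<Rightarrow> (real \<Rightarrow> real)" where
  "kadd a b = (\<lambda>r. a r + b r)"

definition kmul :: "(real \<Rightarrow> real) \<Rightarrow> (real \<Rightarrow> real) \<Rightarrow> (real \<Rightarrow> real)" where
  "kmul a b = (\<lambda>r. \<Sum>p\<in>{p. a p \<noteq> 0 \<and> b (r - p) \<noteq> 0}. a p * b (r - p))"

definition kscale :: "real \<Rightarrow> (real \<Rightarrow> real) \<Rightarrow> (real \<Rightarrow> real)" where
  "kscale c a = (\<lambda>r. c * a r)"

definition ksum :: "nat \<Rightarrow> (nat \<Rightarrow> real \<Rightarrow> real) \<Rightarrow> (real \<Rightarrow> real)" where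
  "ksum n f = (\<lambda>r. \<Sum>j<n. f j r)"

definition kpos :: "(real \<Rightarrow> real) \<Rightarrow> bool" where
  "kpos a \<longleftrightarrow> (\<exists>q. a q > 0 \<and> (\<forall>p<q. a p = 0))"

definition knonneg :: "(real \<Rightarrow> real) \<Rightarrow> bool" where
  "knonneg a \<longleftrightarrow> a = kzero \<or> kpos a"

definition kval :: "(real \<Rightarrow> real) \<Rightarrow> ereal" where
  "kval a = (if a = kzero then \<infinity> else ereal (LEAST r. a r \<noteq> 0))"

text \<open>A polynomial is its coefficient function (nat => nat) => K.\<close>
definition kpoly :: "nat \<Rightarrow> ((nat \<Rightarrow> nat) \<Rightarrow> real \<Rightarrow> real) \<Rightarrow> bool" where
  "kpoly n f \<longleftrightarrow> (\<forall>\<alpha>. puiseux (f \<alpha>)) \<and> finite {\<alpha>. f \<alpha> \<noteq> kzero} \<and>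
     (\<forall>\<alpha>. f \<alpha> \<noteq> kzero \<longrightarrow> in_Nn n \<alpha>)"

definition poly_supp :: "((nat \<Rightarrow> nat) \<Rightarrow> real \<Rightarrow> real) \<Rightarrow> (nat \<Rightarrow> nat) set" where
  "poly_supp f = {\<alpha>. f \<alpha> \<noteq> kzero}"

definition trop :: "((nat \<Rightarrow> nat) \<Rightarrow> real \<Rightarrow> real) \<Rightarrow> (nat \<Rightarrow> nat) \<Rightarrow> ereal" where
  "trop f = (\<lambda>\<alpha>. kval (f \<alpha>))"

definition M_convex_set :: "nat \<Rightarrow> (nat \<Rightarrow> nat) set \<Rightarrow> bool" where
  "M_convex_set n J \<longleftrightarrow> (\<forall>\<alpha>\<in>J. \<forall>\<beta>\<in>J. \<forall>i<n. \<alpha> i > \<beta> i \<longrightarrow>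
      (\<exists>j<n. \<alpha> j < \<beta> j \<and> exch \<alpha> i j \<in> J \<and> exch \<beta> j i \<in> J))"

definition deg :: "nat \<Rightarrow> (nat \<Rightarrow> nat) \<Rightarrow> nat" where
  "deg n \<alpha> = (\<Sum>i<n. \<alpha> i)"

definition unitv :: "nat \<Rightarrow> (nat \<Rightarrow> nat)" where
  "unitv i = (\<lambda>j. if j = i then 1 else 0)"

definition mfact :: "nat \<Rightarrow> (nat \<Rightarrow> nat) \<Rightarrow> real" where
  "mfact n \<beta> = (\<Prod>i<n. fact (\<beta> i))"

text \<open>Hessian of the quadratic form (partial^alpha f): entry (i,j) is
  partial_i partial_j partial^alpha f = (alpha+e_i+e_j)! * c_(alpha+e_i+e_j).\<close>
definition hess :: "nat \<Rightarrow> ((nat \<Rightarrow> nat) \<Rightarrow> real \<Rightarrow> real) \<Rightarrow> (nat \<Rightarrow> nat) \<Rightarrow> nat \<Rightarrow> nat \<Rightarrow> real \<Rightarrow> real" where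
  "hess n f \<alpha> i j = kscale (mfact n (\<lambda>l. \<alpha> l + unitv i l + unitv j l))
                         (f (\<lambda>l. \<alpha> l + unitv i l + unitv j l))"

definition kvec :: "nat \<Rightarrow> (nat \<Rightarrow> real \<Rightarrow> real) \<Rightarrow> bool" where
  "kvec n v \<longleftrightarrow> (\<forall>i<n. puiseux (v i))"

definition keigen :: "nat \<Rightarrow> (nat \<Rightarrow> nat \<Rightarrow> real \<Rightarrow> real) \<Rightarrow> (nat \<Rightarrow> real \<Rightarrow> real) \<Rightarrow> (real \<Rightarrow> real) \<Rightarrow> bool" where
  "keigen n H v l \<longleftrightarrow> (\<forall>i<n. ksum n (\<lambda>j. kmul (H i j) (v j)) = kmul l (v i))"

definition klin_indep :: "nat \<Rightarrow> (nat \<Rightarrow> real \<Rightarrow> real) \<Rightarrow> (nat \<Rightarrow> real \<Rightarrow> real) \<Rightarrow> bool" where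
  "klin_indep n v w \<longleftrightarrow> (\<forall>c d. puiseux c \<longrightarrow> puiseux d \<longrightarrow>
      (\<forall>i<n. kadd (kmul c (v i)) (kmul d (w i)) = kzero) \<longrightarrow> c = kzero \<and> d = kzero)"

text \<open>A symmetric matrix over K has at most one positive eigenvalue (counted
  with multiplicity): there are no two linearly independent eigenvectors with
  positive eigenvalues.\<close>
definition at_most_one_pos_eig :: "nat \<Rightarrow> (nat \<Rightarrow> nat \<Rightarrow> real \<Rightarrow> real) \<Rightarrow> bool" where
  "at_most_one_pos_eig n H \<longleftrightarrow> \<not> (\<exists>v w l1 l2. kvec n v \<and> kvec n w \<and> puiseux l1 \<and> puiseux l2 \<and>
      kpos l1 \<and> kpos l2 \<and> keigen n H v l1 \<and> keigen n H w l2 \<and> klin_indep n v w)"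

definition lorentzian :: "nat \<Rightarrow> ((nat \<Rightarrow> nat) \<Rightarrow> real \<Rightarrow> real) \<Rightarrow> bool" where
  "lorentzian n f \<longleftrightarrow> kpoly n f \<and> (\<exists>d.
      (\<forall>\<alpha>\<in>poly_supp f. deg n \<alpha> = d) \<and> (\<forall>\<alpha>. knonneg (f \<alpha>)) \<and>
      M_convex_set n (poly_supp f) \<and>
      (d \<ge> 2 \<longrightarrow> (\<forall>\<alpha>. in_Nn n \<alpha> \<longrightarrow> deg n \<alpha> = d - 2 \<longrightarrow> at_most_one_pos_eig n (hess n f \<alpha>))))"

end

theory Submission
  imports Defs
begin

text \<open>Membership in the flag Dressian and being a valuated flag matroid differ only by conditions
  that hold for every sequence of valuated matroids, so the content is that each valuated matroid
  \<mu> is the tropicalization of a Lorentzian polynomial. The lift is \<Sum> t^(\<mu> B) x^B. Its second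
  derivatives have Hessian matrices with zero diagonal and entries t^(m i j), where m satisfies the
  four-point condition. Rescaling by a nonzero row p turns such a matrix, evaluated at a small real
  t > 0, into an ultrametric. Ultrametrics are of negative type, so the quadratic form is nonpositive
  on the hyperplane orthogonal to row p, whereas two independent eigenvectors with positive
  eigenvalues would have a nonzero combination in that hyperplane on which it is positive.\<close>

section \<open>Matrices satisfying the four-point condition\<close>

text \<open>Induction on the number of points. With \<open>m\<close> the diameter,
  \<open>M - B\<close> is the sum of the constant matrix \<open>M - m\<close>, whose form is a
  nonnegative multiple of a square, and \<open>m - B\<close>. The latter splits into two diagonal
  blocks, and each block is again the complement of an ultrametric.\<close>

lemma ultrametric_complement_psd:
  fixes B :: "'a \<Rightarrow> 'a \<Rightarrow> real"
  assumes "finite N"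
    and "\<And>i j. i \<in> N \<Longrightarrow> j \<in> N \<Longrightarrow> B i j = B j i"
    and "\<And>i. i \<in> N \<Longrightarrow> B i i = 0"
    and "\<And>i j k. i \<in> N \<Longrightarrow> j \<in> N \<Longrightarrow> k \<in> N \<Longrightarrow> B i j \<le> max (B i k) (B k j)"
    and "\<And>i j. i \<in> N \<Longrightarrow> j \<in> N \<Longrightarrow> B i j \<le> M"
  shows "0 \<le> (\<Sum>i\<in>N. \<Sum>j\<in>N. (M - B i j) * (x i * x j))"
  using assms
proof (induction "card N" arbitrary: N M rule: less_induct)
  case less
  note sym = less.prems(2) and diag = less.prems(3) and ultra = less.prems(4) and bound = less.prems(5)
  show ?case
  proof (cases "N = {}")
    case False
    define m where "m = Max ((\<lambda>(i, j). B i j) ` (N \<times> N))"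
    have fin: "finite ((\<lambda>(i, j). B i j) ` (N \<times> N))" and ne: "(\<lambda>(i, j). B i j) ` (N \<times> N) \<noteq> {}"
      using less.prems(1) False by auto
    have "m \<in> (\<lambda>(i, j). B i j) ` (N \<times> N)"
      unfolding m_def using fin ne by (rule Max_in)
    then obtain i j where ij: "i \<in> N" "j \<in> N" "B i j = m" by auto
    have le_m: "B k l \<le> m" if "k \<in> N" "l \<in> N" for k l
      unfolding m_def using fin that by (intro Max_ge) auto
    have nonneg: "0 \<le> B k l" if "k \<in> N" "l \<in> N" for k l
      using ultra[of k k l] diag[of k] sym[of k l] that by auto
    have m_nonneg: "0 \<le> m" using nonneg[OF ij(1,2)] ij by simp
    have "(\<Sum>k\<in>N. \<Sum>l\<in>N. (M - m) * (x k * x l)) = (M - m) * (\<Sum>k\<in>N. x k)\<^sup>2"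
      by (simp add: power2_eq_square sum_product) (simp add: sum_distrib_left)
    then have shift: "0 \<le> (\<Sum>k\<in>N. \<Sum>l\<in>N. (M - m) * (x k * x l))"
      using bound[OF ij(1,2)] ij(3) by simp
    have "0 \<le> (\<Sum>k\<in>N. \<Sum>l\<in>N. (m - B k l) * (x k * x l))"
    proof (cases "m = 0")
      case True
      have "B k l = 0" if "k \<in> N" "l \<in> N" for k l
        using le_m[OF that] nonneg[OF that] True by simp
      then show ?thesis using True by simp
    next
      case False
      \<comment> \<open>The ball \<open>C\<close> is at constant distance m from its complement, so m - B is block diagonal.\<close>
      define C where "C = {k \<in> N. B i k < m}"
      have iC: "i \<in> C" using False m_nonneg ij diag by (auto simp: C_def)
      have jC: "j \<notin> C" using ij by (auto simp: C_def)
      have CN: "C \<subseteq> N" by (auto simp: C_def)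
      have finC: "finite C" using CN less.prems(1) by (rule finite_subset)
      have cross: "B k l = m" if "k \<in> C" "l \<in> N - C" for k l
      proof -
        have "m \<le> B i l" "B i k < m" using that by (auto simp: C_def)
        then have "m \<le> B k l" using ultra[of i l k] that CN ij by fastforce
        then show ?thesis using le_m[of k l] that CN by auto
      qed
      have cross': "B l k = m" if "k \<in> C" "l \<in> N - C" for k l
        using cross[OF that] sym[of k l] that CN by auto
      \<comment> \<open>Both blocks are strictly smaller than \<open>N\<close>: \<open>j\<close>
        lies outside \<open>C\<close> and \<open>i\<close> inside it.\<close>
      have 1: "0 \<le> (\<Sum>k\<in>C. \<Sum>l\<in>C. (m - B k l) * (x k * x l))"
        using CN jC ij(1,2) less.prems(1) finC
        by (intro less.hyps) (auto intro!: psubset_card_mono sym diag ultra le_m)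
      have 2: "0 \<le> (\<Sum>k\<in>N - C. \<Sum>l\<in>N - C. (m - B k l) * (x k * x l))"
        using iC ij(1,2) less.prems(1)
        by (intro less.hyps) (auto intro!: psubset_card_mono sym diag ultra le_m)
      have parts: "(\<Sum>k\<in>N. g k) = (\<Sum>k\<in>C. g k) + (\<Sum>k\<in>N - C. g k)" for g :: "'a \<Rightarrow> real"
        using sum.subset_diff[OF CN less.prems(1), of g] by simp
      have "(\<Sum>k\<in>N. \<Sum>l\<in>N. (m - B k l) * (x k * x l)) =
          (\<Sum>k\<in>C. \<Sum>l\<in>C. (m - B k l) * (x k * x l)) +
          (\<Sum>k\<in>N - C. \<Sum>l\<in>N - C. (m - B k l) * (x k * x l))"
        by (simp only: parts sum.distrib) (simp add: cross cross')
      then show ?thesis using 1 2 by simp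
    qed
    with shift have "0 \<le> (\<Sum>k\<in>N. \<Sum>l\<in>N. (M - m) * (x k * x l)) +
        (\<Sum>k\<in>N. \<Sum>l\<in>N. (m - B k l) * (x k * x l))" by simp
    also have "\<dots> = (\<Sum>k\<in>N. \<Sum>l\<in>N. (M - B k l) * (x k * x l))"
      by (simp add: sum.distrib[symmetric] algebra_simps)
    finally show ?thesis .
  qed simp
qed

text \<open>For \<open>M\<close> the largest entry, the forms of \<open>M - B\<close> and
  \<open>- B\<close> differ by \<open>M\<close> times the square of the sum of \<open>x\<close>,
  which vanishes here.\<close>

lemma ultrametric_negative_type:
  fixes B :: "'a \<Rightarrow> 'a \<Rightarrow> real"
  assumes "finite N"
    and "\<And>i j. i \<in> N \<Longrightarrow> j \<in> N \<Longrightarrow> B i j = B j i"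
    and "\<And>i. i \<in> N \<Longrightarrow> B i i = 0"
    and "\<And>i j k. i \<in> N \<Longrightarrow> j \<in> N \<Longrightarrow> k \<in> N \<Longrightarrow> B i j \<le> max (B i k) (B k j)"
    and "(\<Sum>i\<in>N. x i) = 0"
  shows "(\<Sum>i\<in>N. \<Sum>j\<in>N. B i j * (x i * x j)) \<le> 0"
proof -
  define M where "M = Max ((\<lambda>(i, j). B i j) ` (N \<times> N))"
  have "B i j \<le> M" if "i \<in> N" "j \<in> N" for i j
    unfolding M_def using that assms(1) by (intro Max_ge) auto
  then have "0 \<le> (\<Sum>i\<in>N. \<Sum>j\<in>N. (M - B i j) * (x i * x j))"
    using assms by (intro ultrametric_complement_psd) auto
  also have "\<dots> = M * (\<Sum>i\<in>N. x i)\<^sup>2 - (\<Sum>i\<in>N. \<Sum>j\<in>N. B i j * (x i * x j))"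
    by (simp add: power2_eq_square sum_product sum_distrib_left sum_subtractf algebra_simps)
  finally show ?thesis using assms(5) by simp
qed

text \<open>On the support \<open>N\<close> of row \<open>p\<close>, dividing \<open>A i j\<close>
  by \<open>A p i * A p j\<close> turns the four-point condition with fourth index \<open>p\<close>
  into the ultrametric inequality. The substitution \<open>x j = A p j * u j\<close> turns the row
  condition into a vanishing sum, so negative type applies. The blocks outside \<open>N\<close>
  contribute nothing.\<close>

lemma four_point_nonpos_on_row_kernel:
  fixes A :: "'a \<Rightarrow> 'a \<Rightarrow> real"
  assumes fin: "finite I"
    and sym: "\<And>i j. A i j = A j i"
    and diag: "\<And>i. A i i = 0"
    and nonneg: "\<And>i j. 0 \<le> A i j"
    and four: "\<And>i j k l. \<lbrakk>i \<in> I; j \<in> I; k \<in> I; l \<in> I; distinct [i, j, k, l]\<rbrakk> \<Longrightarrow>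
      A i j * A k l \<le> max (A i k * A j l) (A i l * A j k)"
    and p: "p \<in> I" and q: "q \<in> I" "A p q \<noteq> 0"
    and row: "(\<Sum>j\<in>I. A p j * u j) = 0"
  shows "(\<Sum>i\<in>I. \<Sum>j\<in>I. A i j * (u i * u j)) \<le> 0"
proof -
  define N where "N = {j \<in> I. A p j \<noteq> 0}"
  have NI: "N \<subseteq> I" and finN: "finite N" using fin by (auto simp: N_def)
  have pos: "0 < A p j" if "j \<in> N" for j using that nonneg[of p j] by (auto simp: N_def)
  have qN: "q \<in> N" and pN: "p \<notin> N" using q diag by (auto simp: N_def)
  have zero: "A p j = 0" "A j p = 0" if "j \<in> I - N" for j
    using that sym[of j p] by (auto simp: N_def)
  define B where "B i j = A i j / (A p i * A p j)" for i j
  define x where "x j = A p j * u j" for j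
  have parts: "(\<Sum>k\<in>I. g k) = (\<Sum>k\<in>N. g k) + (\<Sum>k\<in>I - N. g k)" for g :: "'a \<Rightarrow> real"
    using sum.subset_diff[OF NI fin, of g] by simp
  have sum_x: "(\<Sum>j\<in>N. x j) = 0"
    using row unfolding parts x_def by (simp add: zero)
  have ultra: "B i j \<le> max (B i k) (B k j)" if "i \<in> N" "j \<in> N" "k \<in> N" for i j k
  \<comment> \<open>The four-point hypothesis speaks of distinct indices; coincidences are settled
    by nonnegativity and the zero diagonal.\<close>
  proof (cases "i = j \<or> k = i \<or> k = j")
    case True
    have "0 \<le> B i k" using pos that nonneg by (simp add: B_def)
    then show ?thesis using True diag by (auto simp: B_def)
  next
    case False
    have "A i j * A p k \<le> max (A i p * A j k) (A i k * A j p)"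
      using False that NI p pN by (intro four) auto
    then have "A i j * A p k / (A p i * A p j * A p k)
        \<le> max (A i p * A j k) (A i k * A j p) / (A p i * A p j * A p k)"
      using pos that by (intro divide_right_mono) (auto intro: less_imp_le)
    also have "A i j * A p k / (A p i * A p j * A p k) = B i j"
      using pos[OF that(3)] by (simp add: B_def)
    also have "max (A i p * A j k) (A i k * A j p) / (A p i * A p j * A p k) =
        max (A i p * A j k / (A p i * A p j * A p k)) (A i k * A j p / (A p i * A p j * A p k))"
      using pos[OF that(1)] pos[OF that(2)] pos[OF that(3)] by (simp add: max_divide_distrib_right)
    also have "A i p * A j k / (A p i * A p j * A p k) = B k j"
      using pos[OF that(1)] sym[of i p] sym[of j k] by (simp add: B_def mult.commute)
    also have "A i k * A j p / (A p i * A p j * A p k) = B i k"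
      using pos[OF that(2)] sym[of j p] by (simp add: B_def)
    finally show ?thesis by (simp add: max.commute)
  qed
  have "(\<Sum>i\<in>N. \<Sum>j\<in>N. B i j * (x i * x j)) \<le> 0"
    using finN sum_x ultra sym diag
    by (intro ultrametric_negative_type) (auto simp: B_def mult.commute)
  also have "(\<Sum>i\<in>N. \<Sum>j\<in>N. B i j * (x i * x j)) = (\<Sum>i\<in>N. \<Sum>j\<in>N. A i j * (u i * u j))"
  proof (intro sum.cong refl)
    fix i j assume "i \<in> N" "j \<in> N"
    then show "B i j * (x i * x j) = A i j * (u i * u j)"
      using pos[of i] pos[of j] by (simp add: B_def x_def)
  qed
  finally have main: "(\<Sum>i\<in>N. \<Sum>j\<in>N. A i j * (u i * u j)) \<le> 0" .
  \<comment> \<open>Indices outside \<open>N\<close> are parallel to p or loops: their rows on \<open>N\<close> are multiples of row p.\<close>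
  have row_mult: "A j k = A j q / A p q * A p k" if "j \<in> I - N" "k \<in> N" for j k
  proof (cases "j = p \<or> k = q")
    case False
    \<comment> \<open>Since \<open>A p j = 0\<close>, one product under each maximum vanishes, and
      the two instances become opposite inequalities.\<close>
    have "A p k * A j q \<le> max (A p j * A k q) (A p q * A k j)"
      "A p q * A j k \<le> max (A p j * A q k) (A p k * A q j)"
      using False that NI p pN qN by (intro four; auto)+
    then have "A p k * A j q = A p q * A j k"
      using zero(1)[OF that(1)] sym[of k j] sym[of q j] nonneg
      by (auto intro!: antisym simp: max_def split: if_splits)
    then show ?thesis using pos[OF qN] by (simp add: field_simps)
  qed (use pos[OF qN] in auto)
  have off: "(\<Sum>k\<in>N. A j k * (u j * u k)) = 0" if "j \<in> I - N" for j
  proof -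
    have "(\<Sum>k\<in>N. A j k * (u j * u k)) = (\<Sum>k\<in>N. A j q / A p q * u j * x k)"
    proof (intro sum.cong refl)
      fix k assume "k \<in> N"
      show "A j k * (u j * u k) = A j q / A p q * u j * x k"
        unfolding row_mult[OF that \<open>k \<in> N\<close>] x_def by (simp add: mult_ac)
    qed
    then show ?thesis using sum_x by (simp only: sum_distrib_left[symmetric] mult_zero_right)
  qed
  have null: "A j k = 0" if "j \<in> I - N" "k \<in> I - N" for j k
  proof (cases "j = k \<or> j = p \<or> k = p")
    case False
    have "A j k * A p q \<le> max (A j p * A k q) (A j q * A k p)"
      using False that NI p pN qN by (intro four) auto
    then have "A j k * A p q \<le> 0" using zero that by simp
    then show ?thesis using pos[OF qN] nonneg[of j k] by (simp add: mult_le_0_iff)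
  qed (use diag zero that in auto)
  have "(\<Sum>i\<in>I. \<Sum>j\<in>I. A i j * (u i * u j)) =
      (\<Sum>i\<in>N. \<Sum>j\<in>N. A i j * (u i * u j)) + (\<Sum>i\<in>N. \<Sum>j\<in>I - N. A i j * (u i * u j))
      + (\<Sum>i\<in>I - N. \<Sum>j\<in>N. A i j * (u i * u j))"
    by (simp only: parts sum.distrib) (simp add: null)
  also have "(\<Sum>i\<in>N. \<Sum>j\<in>I - N. A i j * (u i * u j)) = (\<Sum>j\<in>I - N. \<Sum>i\<in>N. A j i * (u j * u i))"
    by (subst sum.swap) (auto intro!: sum.cong simp: sym[of _ "_"] mult_ac)
  finally show ?thesis using main by (simp add: off)
qed

section \<open>Evaluation of convergent Puiseux series\<close>

no_notation Infinite_Set_Sum.abs_summable_on (infix "abs'_summable'_on" 50)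

text \<open>Absolute convergence is what permits the regrouping of double sums when products are
  evaluated.\<close>

definition kconv :: "real \<Rightarrow> (real \<Rightarrow> real) \<Rightarrow> bool" where
  "kconv s a \<longleftrightarrow> (\<lambda>r. a r * s powr r) abs_summable_on UNIV"

definition keval :: "real \<Rightarrow> (real \<Rightarrow> real) \<Rightarrow> real" where
  "keval s a = (\<Sum>\<^sub>\<infinity>r. a r * s powr r)"

lemma puiseux_finite: "puiseux a \<Longrightarrow> finite {r. a r \<noteq> 0 \<and> r \<le> c}"
  by (simp add: puiseux_def)

lemma kconv_summable: "kconv s a \<Longrightarrow> (\<lambda>r. a r * s powr r) summable_on UNIV"
  unfolding kconv_def by (rule Infinite_Sum.abs_summable_summable)

text \<open>For \<open>r \<ge> q\<close> the ratio \<open>s' / s \<le> 1\<close> satisfies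
  \<open>(s' / s) powr r \<le> (s' / s) powr q\<close>. This gives both convergence at smaller
  arguments and the size of a series of order at least \<open>q\<close>.\<close>

lemma powr_term_le:
  fixes s s' :: real
  assumes "\<And>r. r < q \<Longrightarrow> a r = 0" "0 < s'" "s' \<le> s"
  shows "norm (a r * s' powr r) \<le> norm ((s' / s) powr q * (a r * s powr r))"
proof (cases "r < q")
  case False
  have "s' powr r = (s' / s) powr r * s powr r"
    using assms(2,3) by (simp add: powr_divide)
  also have "\<dots> \<le> (s' / s) powr q * s powr r"
    using assms(2,3) False by (intro mult_right_mono powr_mono') auto
  finally have "\<bar>a r\<bar> * s' powr r \<le> \<bar>a r\<bar> * ((s' / s) powr q * s powr r)"
    by (rule mult_left_mono) simp
  then show ?thesis by (simp add: abs_mult mult_ac)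
qed (use assms in simp)

lemma kconv_mono:
  assumes "\<And>r. r < q \<Longrightarrow> a r = 0" "kconv s a" "0 < s'" "s' \<le> s"
  shows "kconv s' a"
  unfolding kconv_def
proof (rule Infinite_Sum.abs_summable_on_comparison_test)
  show "(\<lambda>r. (s' / s) powr q * (a r * s powr r)) abs_summable_on UNIV"
    using assms(2) unfolding kconv_def norm_mult[of "(s' / s) powr q"]
    by (rule summable_on_cmult_right)
qed (use powr_term_le[OF assms(1,3,4)] in auto)

text \<open>Below the exponent \<open>c\<close> of some nonzero term the support is finite, so it
  has a least element.\<close>

lemma puiseux_order:
  assumes "puiseux a" "a \<noteq> kzero"
  obtains q where "a q \<noteq> 0" "\<And>r. r < q \<Longrightarrow> a r = 0"
proof -
  obtain c where "a c \<noteq> 0" using assms(2) by (auto simp: kzero_def fun_eq_iff)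
  define S where "S = {r. a r \<noteq> 0 \<and> r \<le> c}"
  have S: "finite S" "c \<in> S"
    using assms(1) \<open>a c \<noteq> 0\<close> by (auto simp: puiseux_def S_def)
  show thesis
  proof
    show "a (Min S) \<noteq> 0" using Min_in[OF S(1)] S(2) by (auto simp: S_def)
    show "a r = 0" if "r < Min S" for r
    proof (rule ccontr)
      assume "a r \<noteq> 0"
      moreover have "Min S \<le> c" using S by simp
      ultimately have "r \<in> S" using that by (simp add: S_def)
      then have "Min S \<le> r" using S(1) by (intro Min_le)
      then show False using that by linarith
    qed
  qed
qed

lemma puiseux_bounded_below:
  assumes "puiseux a"
  obtains q where "\<And>r. r < q \<Longrightarrow> a r = 0"
proof (cases "a = kzero")
  case True
  then show thesis using that[of 0] by (simp add: kzero_def)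
qed (use puiseux_order[OF assms] that in blast)

text \<open>Convergence at one point passes to all smaller positive ones, so finitely many series
  can be evaluated at a common small argument.\<close>

lemma eventually_kconv:
  assumes "puiseux a"
  shows "eventually (\<lambda>s. kconv s a) (at_right 0)"
proof -
  obtain q where q: "\<And>r. r < q \<Longrightarrow> a r = 0" using puiseux_bounded_below[OF assms] by blast
  obtain s where "s > 0" "kconv s a" using assms by (auto simp: puiseux_def kconv_def)
  have "kconv s' a" if "0 < s'" "s' < s" for s'
    using q \<open>kconv s a\<close> that(1) less_imp_le[OF that(2)] by (rule kconv_mono)
  then show ?thesis
    unfolding eventually_at_right_field using \<open>s > 0\<close> by blast
qed

lemma puiseuxI:
  assumes "\<And>c. finite {r. a r \<noteq> 0 \<and> r \<le> c}" "eventually (\<lambda>s. kconv s a) (at_right 0)"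
  shows "puiseux a"
proof -
  have "eventually (\<lambda>s. 0 < s \<and> kconv s a) (at_right (0::real))"
    using assms(2) eventually_at_right_less by eventually_elim auto
  then obtain s where "0 < s" "kconv s a"
    using eventually_happens'[OF trivial_limit_at_right_real] by blast
  then show ?thesis using assms(1) unfolding puiseux_def kconv_def by auto
qed

lemma puiseux_finite_support:
  assumes "finite {r. a r \<noteq> 0}"
  shows "puiseux a"
proof (rule puiseuxI)
  show "finite {r. a r \<noteq> 0 \<and> r \<le> c}" for c
    by (rule finite_subset[OF _ assms]) auto
  have "kconv s a" for s
  proof -
    have "(\<lambda>r. norm (a r * s powr r)) summable_on UNIV \<longleftrightarrow>
        (\<lambda>r. norm (a r * s powr r)) summable_on {r. a r \<noteq> 0}"
      by (rule summable_on_cong_neutral) auto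
    then show ?thesis unfolding kconv_def using assms by simp
  qed
  then show "eventually (\<lambda>s. kconv s a) (at_right 0)" by simp
qed

section \<open>Compatibility of evaluation with the ring operations\<close>

lemma kconv_kadd: "kconv s a \<Longrightarrow> kconv s b \<Longrightarrow> kconv s (kadd a b)"
  unfolding kconv_def kadd_def distrib_right
  by (simp only: summable_on_iff_abs_summable_on_real[symmetric] summable_on_add)

lemma keval_kadd: "kconv s a \<Longrightarrow> kconv s b \<Longrightarrow> keval s (kadd a b) = keval s a + keval s b"
  unfolding keval_def kadd_def distrib_right by (intro infsum_add kconv_summable)

lemma puiseux_kadd:
  assumes "puiseux a" "puiseux b"
  shows "puiseux (kadd a b)"
proof (rule puiseuxI)
  show "finite {r. kadd a b r \<noteq> 0 \<and> r \<le> c}" for c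
    by (rule finite_subset[OF _ finite_UnI[OF puiseux_finite[OF assms(1)] puiseux_finite[OF assms(2)]]])
      (auto simp: kadd_def)
  show "eventually (\<lambda>s. kconv s (kadd a b)) (at_right 0)"
    using eventually_kconv[OF assms(1)] eventually_kconv[OF assms(2)]
    by eventually_elim (rule kconv_kadd)
qed

lemma kscale_eval:
  shows kconv_kscale: "kconv s a \<Longrightarrow> kconv s (kscale c a)"
    and keval_kscale: "keval s (kscale c a) = c * keval s a"
  by (simp_all add: kconv_def keval_def kscale_def mult.assoc infsum_cmult_right' abs_mult summable_on_cmult_right)

lemma puiseux_kscale:
  assumes "puiseux a"
  shows "puiseux (kscale c a)"
proof (rule puiseuxI)
  show "finite {r. kscale c a r \<noteq> 0 \<and> r \<le> d}" for d
    by (rule finite_subset[OF _ puiseux_finite[OF assms]]) (auto simp: kscale_def)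
  show "eventually (\<lambda>s. kconv s (kscale c a)) (at_right 0)"
    using eventually_kconv[OF assms] by eventually_elim (rule kconv_kscale)
qed

lemma ksum_0: "ksum 0 f = kzero"
  and ksum_Suc: "ksum (Suc n) f = kadd (ksum n f) (f n)"
  by (auto simp: ksum_def kzero_def kadd_def)

lemma keval_kzero: "kconv s kzero" "keval s kzero = 0"
  by (simp_all add: kconv_def keval_def kzero_def)

lemma puiseux_kzero: "puiseux kzero"
  by (rule puiseux_finite_support) (simp add: kzero_def)

lemma puiseux_ksum: "(\<And>j. j < n \<Longrightarrow> puiseux (f j)) \<Longrightarrow> puiseux (ksum n f)"
  by (induction n) (simp_all add: ksum_0 ksum_Suc puiseux_kzero puiseux_kadd)

lemma keval_ksum:
  assumes "\<And>j. j < n \<Longrightarrow> kconv s (f j)"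
  shows "keval s (ksum n f) = (\<Sum>j<n. keval s (f j))"
proof -
  have "kconv s (ksum n f) \<and> keval s (ksum n f) = (\<Sum>j<n. keval s (f j))"
    using assms by (induction n) (simp_all add: ksum_0 ksum_Suc keval_kzero kconv_kadd keval_kadd)
  then show ?thesis ..
qed

text \<open>Both supports are bounded below, so a bound on \<open>p + q\<close> bounds
  \<open>p\<close> and \<open>q\<close> separately from above.\<close>

lemma finite_kmul_support:
  assumes "puiseux a" "puiseux b"
  shows "finite {(p, q). a p \<noteq> 0 \<and> b q \<noteq> 0 \<and> p + q \<le> c}"
proof -
  obtain a0 where a0: "\<And>r. r < a0 \<Longrightarrow> a r = 0" using puiseux_bounded_below[OF assms(1)] by blast
  obtain b0 where b0: "\<And>r. r < b0 \<Longrightarrow> b r = 0" using puiseux_bounded_below[OF assms(2)] by blast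
  have "finite ({p. a p \<noteq> 0 \<and> p \<le> c - b0} \<times> {q. b q \<noteq> 0 \<and> q \<le> c - a0})"
    using assms by (intro finite_cartesian_product puiseux_finite)
  moreover have "{(p, q). a p \<noteq> 0 \<and> b q \<noteq> 0 \<and> p + q \<le> c} \<subseteq>
      {p. a p \<noteq> 0 \<and> p \<le> c - b0} \<times> {q. b q \<noteq> 0 \<and> q \<le> c - a0}"
  proof (rule subrelI)
    fix p q assume "(p, q) \<in> {(p, q). a p \<noteq> 0 \<and> b q \<noteq> 0 \<and> p + q \<le> c}"
    then have *: "a p \<noteq> 0" "b q \<noteq> 0" "p + q \<le> c" by auto
    have "a0 \<le> p" using a0[of p] * by force
    moreover have "b0 \<le> q" using b0[of q] * by force
    ultimately show "(p, q) \<in> {p. a p \<noteq> 0 \<and> p \<le> c - b0} \<times> {q. b q \<noteq> 0 \<and> q \<le> c - a0}"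
      using * by auto
  qed
  ultimately show ?thesis by (rule finite_subset[rotated])
qed

lemma finite_kmul_fibre:
  assumes "puiseux a" "puiseux b"
  shows "finite {p. a p \<noteq> 0 \<and> b (r - p) \<noteq> 0}"
proof -
  have "(\<lambda>p. (p, r - p)) ` {p. a p \<noteq> 0 \<and> b (r - p) \<noteq> 0} \<subseteq> {(p, q). a p \<noteq> 0 \<and> b q \<noteq> 0 \<and> p + q \<le> r}"
    by auto
  then show ?thesis
    using finite_kmul_support[OF assms] by (meson finite_subset finite_imageD inj_onI prod.inject)
qed

text \<open>Cauchy product: \<open>F\<close> is the absolutely summable family of all products of
  terms, and \<open>G\<close> is the same family in the coordinates \<open>(p + q, p)\<close>.
  Summing \<open>G\<close> over \<open>p\<close> for fixed \<open>r\<close> yields the term of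
  exponent \<open>r\<close> of the product.\<close>

lemma kmul_eval:
  assumes "puiseux a" "puiseux b" "kconv s a" "kconv s b" "0 < s"
  shows kconv_kmul: "kconv s (kmul a b)"
    and keval_kmul: "keval s (kmul a b) = keval s a * keval s b"
proof -
  define F where "F = (\<lambda>(p, q). (a p * s powr p) * (b q * s powr q))"
  define G where "G = (\<lambda>(r, p). F (p, r - p))"
  have absF: "F abs_summable_on UNIV \<times> UNIV"
    unfolding Infinite_Sum.abs_summable_on_Sigma_iff
  proof (intro conjI ballI)
    show "(\<lambda>q. F (p, q)) abs_summable_on UNIV" for p
      using assms(4) by (simp add: F_def kconv_def norm_mult[of "a p * s powr p"] summable_on_cmult_right
        del: real_norm_def)
    have "(\<Sum>\<^sub>\<infinity>q. norm (F (p, q))) = norm (a p * s powr p) * (\<Sum>\<^sub>\<infinity>q. norm (b q * s powr q))" for p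
      by (simp add: F_def norm_mult[of "a p * s powr p"] infsum_cmult_right' del: real_norm_def)
    then show "(\<lambda>p. \<Sum>\<^sub>\<infinity>q. norm (F (p, q))) abs_summable_on UNIV"
      using summable_on_cmult_left[OF assms(3)[unfolded kconv_def]]
      by (simp only: summable_on_iff_abs_summable_on_real[symmetric])
  qed
  have "G abs_summable_on UNIV \<times> UNIV \<longleftrightarrow> F abs_summable_on UNIV \<times> UNIV"
    by (rule summable_on_reindex_bij_witness[of _ "\<lambda>(p, q). (p + q, p)" "\<lambda>(r, p). (p, r - p)"])
      (auto simp: G_def)
  then have absG: "G abs_summable_on UNIV \<times> UNIV" using absF by simp
  have infG: "infsum G (UNIV \<times> UNIV) = infsum F (UNIV \<times> UNIV)"
    by (rule infsum_reindex_bij_witness[of _ "\<lambda>(p, q). (p + q, p)" "\<lambda>(r, p). (p, r - p)"])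
      (auto simp: G_def)
  have fibre: "(\<Sum>\<^sub>\<infinity>p. G (r, p)) = kmul a b r * s powr r" for r
  proof -
    let ?S = "{p. a p \<noteq> 0 \<and> b (r - p) \<noteq> 0}"
    have "(\<Sum>\<^sub>\<infinity>p. G (r, p)) = infsum (\<lambda>p. a p * b (r - p) * s powr r) ?S"
    proof (rule infsum_cong_neutral)
      fix p
      have "s powr r = s powr p * s powr (r - p)" by (simp add: powr_add[symmetric])
      then show "G (r, p) = a p * b (r - p) * s powr r" by (simp add: G_def F_def)
    qed (auto simp: G_def F_def)
    also have "\<dots> = (\<Sum>p\<in>?S. a p * b (r - p) * s powr r)"
      using finite_kmul_fibre[OF assms(1,2)] by (rule infsum_finite)
    finally show ?thesis by (simp add: kmul_def sum_distrib_right)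
  qed
  show "kconv s (kmul a b)"
    unfolding kconv_def
  proof (rule Infinite_Sum.abs_summable_on_comparison_test)
    have G: "(\<lambda>p. G (r, p)) abs_summable_on UNIV" for r
      using absG unfolding Infinite_Sum.abs_summable_on_Sigma_iff by blast
    show "(\<lambda>r. \<Sum>\<^sub>\<infinity>p. norm (G (r, p))) abs_summable_on UNIV"
      using absG unfolding Infinite_Sum.abs_summable_on_Sigma_iff by blast
    show "norm (kmul a b r * s powr r) \<le> norm (\<Sum>\<^sub>\<infinity>p. norm (G (r, p)))" for r
      unfolding fibre[symmetric] using norm_infsum_bound[OF G] by (rule order_trans) simp
  qed
  have "keval s (kmul a b) = (\<Sum>\<^sub>\<infinity>r. \<Sum>\<^sub>\<infinity>p. G (r, p))"
    by (simp add: keval_def fibre)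
  also have "\<dots> = infsum F (UNIV \<times> UNIV)"
    using infsum_Sigma_banach[OF Infinite_Sum.abs_summable_summable[OF absG]] infG by simp
  also have "\<dots> = (\<Sum>\<^sub>\<infinity>p. \<Sum>\<^sub>\<infinity>q. F (p, q))"
    using infsum_Sigma_banach[OF Infinite_Sum.abs_summable_summable[OF absF]] by simp
  also have "\<dots> = keval s a * keval s b"
    by (simp add: F_def infsum_cmult_right' infsum_cmult_left' keval_def)
  finally show "keval s (kmul a b) = keval s a * keval s b" .
qed

lemma puiseux_kmul:
  assumes "puiseux a" "puiseux b"
  shows "puiseux (kmul a b)"
proof (rule puiseuxI)
  show "finite {r. kmul a b r \<noteq> 0 \<and> r \<le> c}" for c
  proof (rule finite_subset)
    show "finite ((\<lambda>(p, q). p + q) ` {(p, q). a p \<noteq> 0 \<and> b q \<noteq> 0 \<and> p + q \<le> c})"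
      using finite_kmul_support[OF assms] by (rule finite_imageI)
    show "{r. kmul a b r \<noteq> 0 \<and> r \<le> c} \<subseteq> (\<lambda>(p, q). p + q) ` {(p, q). a p \<noteq> 0 \<and> b q \<noteq> 0 \<and> p + q \<le> c}"
    proof (rule subsetI)
      fix r assume "r \<in> {r. kmul a b r \<noteq> 0 \<and> r \<le> c}"
      then have r: "kmul a b r \<noteq> 0" "r \<le> c" by auto
      have "{p. a p \<noteq> 0 \<and> b (r - p) \<noteq> 0} \<noteq> {}"
      proof
        assume "{p. a p \<noteq> 0 \<and> b (r - p) \<noteq> 0} = {}"
        then have "kmul a b r = 0" by (simp only: kmul_def sum.empty)
        with r show False by simp
      qed
      then obtain p where "a p \<noteq> 0" "b (r - p) \<noteq> 0" by auto
      then show "r \<in> (\<lambda>(p, q). p + q) ` {(p, q). a p \<noteq> 0 \<and> b q \<noteq> 0 \<and> p + q \<le> c}"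
        using r by (intro image_eqI[of _ _ "(p, r - p)"]) auto
    qed
  qed
  show "eventually (\<lambda>s. kconv s (kmul a b)) (at_right 0)"
    using eventually_kconv[OF assms(1)] eventually_kconv[OF assms(2)] eventually_at_right_less
    by eventually_elim (rule kconv_kmul[OF assms])
qed

section \<open>Signs of Puiseux series read off near zero\<close>

lemma kpos_keval:
  assumes "puiseux a" "kpos a"
  shows "eventually (\<lambda>s. 0 < keval s a) (at_right 0)"
proof -
  obtain q where q: "0 < a q" and below: "\<And>p. p < q \<Longrightarrow> a p = 0"
    using assms(2) by (auto simp: kpos_def)
  \<comment> \<open>The tail b has order q' > q, hence is O(s^q') and dominated by the leading term.\<close>
  define b where "b = a(q := 0)"
  have b: "puiseux b"
  proof (rule puiseuxI)
    show "finite {r. b r \<noteq> 0 \<and> r \<le> c}" for c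
      by (rule finite_subset[OF _ puiseux_finite[OF assms(1)]]) (auto simp: b_def)
    show "eventually (\<lambda>s. kconv s b) (at_right 0)"
      using eventually_kconv[OF assms(1)] unfolding kconv_def
      by eventually_elim (erule Infinite_Sum.abs_summable_on_comparison_test, simp add: b_def)
  qed
  obtain q' where "q < q'" and gap: "\<And>r. r < q' \<Longrightarrow> b r = 0"
  proof (cases "b = kzero")
    case True
    \<comment> \<open>A zero tail admits any bound beyond \<open>q\<close>.\<close>
    then show thesis using that[of "q + 1"] by (simp add: kzero_def)
  next
    case False
    then obtain q' where q': "b q' \<noteq> 0" "\<And>r. r < q' \<Longrightarrow> b r = 0"
      using puiseux_order[OF b] by blast
    then have "q < q'" using below[of q'] by (cases q q' rule: linorder_cases) (auto simp: b_def)
    then show thesis using that q' by blast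
  qed
  obtain s0 where s0: "s0 > 0" "kconv s0 b" using b by (auto simp: puiseux_def kconv_def)
  \<comment> \<open>Factoring \<open>(s / s0) powr q'\<close> out of the tail bounds its value at
    \<open>s < s0\<close> by \<open>C * s powr q'\<close>.\<close>
  define C where "C = (\<Sum>\<^sub>\<infinity>r. norm (b r * s0 powr r)) / s0 powr q'"
  have "((\<lambda>s. s powr (q' - q)) \<longlongrightarrow> 0 powr (q' - q)) (at_right 0)"
    using \<open>q < q'\<close> by (intro tendsto_powr' tendsto_intros) (auto simp: eventually_at_filter)
  from tendsto_mult_left[OF this, of C]
  have "((\<lambda>s. C * s powr (q' - q)) \<longlongrightarrow> 0) (at_right 0)" by simp
  then have small: "eventually (\<lambda>s. C * s powr (q' - q) < a q) (at_right 0)"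
    using q by (auto dest: order_tendstoD(2))
  have "eventually (\<lambda>s. s < s0) (at_right 0)"
    using s0(1) by (auto simp: eventually_at_right_field)
  then show ?thesis
    using small eventually_at_right_less
  proof eventually_elim
    case (elim s)
    have bs: "kconv s b" using kconv_mono[OF gap s0(2)] elim by simp
    have "norm (keval s b) \<le> (\<Sum>\<^sub>\<infinity>r. norm (b r * s powr r))"
      unfolding keval_def using bs[unfolded kconv_def] by (rule norm_infsum_bound)
    also have "\<dots> \<le> (\<Sum>\<^sub>\<infinity>r. (s / s0) powr q' * norm (b r * s0 powr r))"
    proof (rule infsum_mono)
      show "(\<lambda>r. (s / s0) powr q' * norm (b r * s0 powr r)) summable_on UNIV"
        using s0(2) unfolding kconv_def by (rule summable_on_cmult_right)
      show "norm (b r * s powr r) \<le> (s / s0) powr q' * norm (b r * s0 powr r)" for r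
        using powr_term_le[of q' b s s0 r, OF gap] elim by (simp add: abs_mult)
    qed (use bs in \<open>simp add: kconv_def\<close>)
    also have "\<dots> = C * s powr q'"
      unfolding infsum_cmult_right' C_def using elim s0(1) by (simp add: powr_divide)
    also have "\<dots> = C * s powr (q' - q) * s powr q"
      by (simp add: powr_add[symmetric])
    also have "\<dots> < a q * s powr q"
      using elim by (intro mult_strict_right_mono) auto
    finally have lt: "norm (keval s b) < a q * s powr q" .
    \<comment> \<open>The leading monomial as a series of its own, so that \<open>a\<close> is
      \<open>m\<close> plus the tail.\<close>
    define m where "m = (\<lambda>r. if r = q then a q else 0)"
    have m: "kconv s m" "keval s m = a q * s powr q"
    proof -
      have "(\<lambda>r. norm (m r * s powr r)) summable_on UNIV \<longleftrightarrow> (\<lambda>r. norm (m r * s powr r)) summable_on {q}"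
        by (rule summable_on_cong_neutral) (auto simp: m_def)
      then show "kconv s m" by (simp add: kconv_def)
      have "keval s m = (\<Sum>\<^sub>\<infinity>r\<in>{q}. m r * s powr r)"
        unfolding keval_def by (rule infsum_cong_neutral) (auto simp: m_def)
      then show "keval s m = a q * s powr q" by (simp add: m_def)
    qed
    have "a = kadd m b" by (auto simp: kadd_def m_def b_def)
    then have "keval s a = a q * s powr q + keval s b"
      using keval_kadd[OF m(1) bs] m(2) by simp
    then show ?case using lt by auto
  qed
qed

text \<open>Multiplied by the sign of its leading coefficient, a nonzero series becomes positive,
  and its values near 0 are then positive. Identities between series can thus be checked at small
  real arguments.\<close>

lemma keval_eventually_0_imp_kzero:
  assumes "puiseux a" "eventually (\<lambda>s. keval s a = 0) (at_right 0)"
  shows "a = kzero"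
proof (rule ccontr)
  assume "a \<noteq> kzero"
  then obtain q where q: "a q \<noteq> 0" "\<And>r. r < q \<Longrightarrow> a r = 0"
    using puiseux_order[OF assms(1)] by blast
  define c :: real where "c = sgn (a q)"
  have "kpos (kscale c a)"
    using q by (auto simp: kpos_def kscale_def c_def sgn_if intro!: exI[of _ q])
  then have "eventually (\<lambda>s. 0 < keval s (kscale c a)) (at_right 0)"
    using kpos_keval puiseux_kscale[OF assms(1)] by blast
  then have "eventually (\<lambda>s::real. False) (at_right 0)"
    using assms(2) by eventually_elim (simp add: keval_kscale)
  then show False by simp
qed

section \<open>Positive eigenvalues\<close>

text \<open>Pairing the eigenvalue equation with \<open>v\<close> equates \<open>l\<close> times the
  squared norm of \<open>v\<close> with the quadratic form at \<open>v\<close>, which is nonpositive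
  on the kernel of \<open>\<phi>\<close>.\<close>

lemma eigenvector_in_kernel_zero:
  fixes A :: "nat \<Rightarrow> nat \<Rightarrow> real"
  assumes eig: "\<And>i. i < n \<Longrightarrow> (\<Sum>j<n. A i j * v j) = l * v i" and "0 < l"
    and neg: "\<And>u. (\<Sum>j<n. \<phi> j * u j) = 0 \<Longrightarrow> (\<Sum>i<n. \<Sum>j<n. A i j * (u i * u j)) \<le> 0"
    and "(\<Sum>j<n. \<phi> j * v j) = 0" and "i < n"
  shows "v i = 0"
proof -
  have "l * (\<Sum>i<n. (v i)\<^sup>2) = (\<Sum>i<n. v i * (\<Sum>j<n. A i j * v j))"
    by (simp add: eig) (simp add: sum_distrib_left power2_eq_square mult_ac)
  also have "\<dots> = (\<Sum>i<n. \<Sum>j<n. A i j * (v i * v j))"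
    by (simp add: sum_distrib_left mult_ac)
  also have "\<dots> \<le> 0" using assms(4) by (rule neg)
  finally have "(\<Sum>i<n. (v i)\<^sup>2) \<le> 0" using \<open>0 < l\<close> by (simp add: mult_le_0_iff)
  then have "(\<Sum>i<n. (v i)\<^sup>2) = 0" by (intro antisym sum_nonneg) auto
  then show ?thesis using \<open>i < n\<close> by (simp add: sum_nonneg_eq_0_iff)
qed

text \<open>The combination lies in the kernel of \<open>\<phi>\<close>. If the eigenvalues agree it
  satisfies the same eigenvalue equation; otherwise \<open>v\<close> and \<open>w\<close> are
  orthogonal and the form is a sum of nonnegative terms. The coefficients are written without
  division, so the same expressions make sense for series.\<close>

lemma positive_eigenvectors_dependent:
  fixes A :: "nat \<Rightarrow> nat \<Rightarrow> real"
  assumes sym: "\<And>i j. A i j = A j i"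
    and v: "\<And>i. i < n \<Longrightarrow> (\<Sum>j<n. A i j * v j) = l1 * v i" "0 < l1"
    and w: "\<And>i. i < n \<Longrightarrow> (\<Sum>j<n. A i j * w j) = l2 * w i" "0 < l2"
    and neg: "\<And>u. (\<Sum>j<n. \<phi> j * u j) = 0 \<Longrightarrow> (\<Sum>i<n. \<Sum>j<n. A i j * (u i * u j)) \<le> 0"
    and "i < n"
  shows "(\<Sum>j<n. \<phi> j * w j) * v i + (- (\<Sum>j<n. \<phi> j * v j)) * w i = 0"
proof -
  define c where "c = (\<Sum>j<n. \<phi> j * w j)"
  define d where "d = - (\<Sum>j<n. \<phi> j * v j)"
  define u where "u i = c * v i + d * w i" for i
  have "(\<Sum>j<n. \<phi> j * u j) = c * (\<Sum>j<n. \<phi> j * v j) + d * (\<Sum>j<n. \<phi> j * w j)"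
    by (simp add: u_def sum.distrib sum_distrib_left algebra_simps)
  then have ker: "(\<Sum>j<n. \<phi> j * u j) = 0" by (simp add: c_def d_def)
  have Au: "(\<Sum>j<n. A i j * u j) = c * l1 * v i + d * l2 * w i" if "i < n" for i
  proof -
    have "(\<Sum>j<n. A i j * u j) = c * (\<Sum>j<n. A i j * v j) + d * (\<Sum>j<n. A i j * w j)"
      by (simp add: u_def sum.distrib sum_distrib_left algebra_simps)
    then show ?thesis using v w that by simp
  qed
  have "u i = 0"
  proof (cases "l1 = l2")
    case True
    show ?thesis
    proof (rule eigenvector_in_kernel_zero)
      show "(\<Sum>j<n. A i j * u j) = l1 * u i" if "i < n" for i
        using Au[OF that] True by (simp add: u_def algebra_simps)
    qed (use v(2) neg ker \<open>i < n\<close> in auto)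
  next
    case False
    \<comment> \<open>Symmetry of \<open>A\<close> lets it act on either factor of the inner
      product, giving \<open>l1\<close> and \<open>l2\<close> times the same number.\<close>
    have "l1 * (\<Sum>i<n. v i * w i) = (\<Sum>i<n. w i * (\<Sum>j<n. A i j * v j))"
      by (simp add: v) (simp add: sum_distrib_left mult_ac)
    also have "\<dots> = (\<Sum>j<n. \<Sum>i<n. w i * (A i j * v j))"
      unfolding sum_distrib_left by (rule sum.swap)
    also have "\<dots> = (\<Sum>j<n. v j * (\<Sum>i<n. A j i * w i))"
      by (simp add: sum_distrib_left sym[of _ "_ :: nat"] mult_ac)
    also have "\<dots> = l2 * (\<Sum>i<n. v i * w i)"
      by (simp add: w) (simp add: sum_distrib_left mult_ac)
    finally have orth: "(\<Sum>i<n. v i * w i) = 0" using False by simp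
    have "(\<Sum>i<n. \<Sum>j<n. A i j * (u i * u j)) = (\<Sum>i<n. u i * (\<Sum>j<n. A i j * u j))"
      by (simp add: sum_distrib_left mult_ac)
    also have "\<dots> = (\<Sum>i<n. u i * (c * l1 * v i + d * l2 * w i))"
      by (simp add: Au)
    \<comment> \<open>The mixed terms collect into a multiple of the inner product of
      \<open>v\<close> and \<open>w\<close>, which is zero.\<close>
    also have "\<dots> = (\<Sum>i<n. l1 * (c * v i)\<^sup>2 + l2 * (d * w i)\<^sup>2) + c * d * (l1 + l2) * (\<Sum>i<n. v i * w i)"
      unfolding sum_distrib_left sum.distrib[symmetric]
      by (intro sum.cong) (auto simp: u_def power2_eq_square algebra_simps)
    finally have "(\<Sum>i<n. l1 * (c * v i)\<^sup>2 + l2 * (d * w i)\<^sup>2) \<le> 0"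
      using neg[OF ker] orth by simp
    then have "(\<Sum>i<n. l1 * (c * v i)\<^sup>2 + l2 * (d * w i)\<^sup>2) = 0"
      using v(2) w(2) by (intro antisym sum_nonneg) auto
    then have "l1 * (c * v i)\<^sup>2 + l2 * (d * w i)\<^sup>2 = 0"
      using v(2) w(2) \<open>i < n\<close> by (subst (asm) sum_nonneg_eq_0_iff) auto
    moreover have "0 \<le> l1 * (c * v i)\<^sup>2" "0 \<le> l2 * (d * w i)\<^sup>2" using v(2) w(2) by auto
    ultimately have "l1 * (c * v i)\<^sup>2 = 0" "l2 * (d * w i)\<^sup>2 = 0" by linarith+
    then show ?thesis using v(2) w(2) by (auto simp: u_def)
  qed
  then show ?thesis by (simp add: u_def c_def d_def)
qed

text \<open>The real dependence relation holds at all small \<open>s\<close>, hence for the series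
  themselves. Independence then forces its coefficients to vanish, in particular the pairing of
  \<open>\<phi>\<close> with \<open>v\<close>. So \<open>v\<close> itself lies in the kernel and
  must be zero, contradicting independence.\<close>

lemma at_most_one_pos_eigI:
  assumes H: "\<And>i j. puiseux (H i j)"
    and sym: "\<And>i j. H i j = H j i"
    and phi: "\<And>j. puiseux (\<phi> j)"
    and neg: "eventually (\<lambda>s. \<forall>u. (\<Sum>j<n. keval s (\<phi> j) * u j) = 0 \<longrightarrow>
      (\<Sum>i<n. \<Sum>j<n. keval s (H i j) * (u i * u j)) \<le> 0) (at_right 0)"
  shows "at_most_one_pos_eig n H"
  unfolding at_most_one_pos_eig_def
proof clarify
  fix v w l1 l2
  assume kv: "kvec n v" "kvec n w" and l: "puiseux l1" "puiseux l2" "kpos l1" "kpos l2"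
    and eig: "keigen n H v l1" "keigen n H w l2" and indep: "klin_indep n v w"
  have pv: "puiseux (v i)" and pw: "puiseux (w i)" if "i < n" for i
    using kv that by (auto simp: kvec_def)
  \<comment> \<open>The coefficients make \<open>c v + d w\<close> orthogonal to \<phi>.\<close>
  define c where "c = ksum n (\<lambda>j. kmul (\<phi> j) (w j))"
  define d where "d = kscale (-1) (ksum n (\<lambda>j. kmul (\<phi> j) (v j)))"
  have pc: "puiseux c" and pd: "puiseux d"
    unfolding c_def d_def by (auto intro!: puiseux_kscale puiseux_ksum puiseux_kmul phi pv pw)
  have fin: "eventually (\<lambda>s. \<forall>i<n. kconv s (g i)) (at_right 0)"
    if "\<And>i. i < n \<Longrightarrow> puiseux (g i)" for g
  proof -
    have "eventually (\<lambda>s. \<forall>i\<in>{..<n}. kconv s (g i)) (at_right 0)"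
      using that eventually_kconv by (intro eventually_ball_finite) auto
    then show ?thesis by eventually_elim auto
  qed
  have "eventually (\<lambda>s. \<forall>i\<in>{..<n}. \<forall>j<n. kconv s (H i j)) (at_right 0)"
    using fin[OF H] by (intro eventually_ball_finite) auto
  then have "eventually (\<lambda>s. \<forall>i<n. \<forall>j<n. kconv s (H i j)) (at_right 0)"
    by eventually_elim auto
  moreover have "eventually (\<lambda>s. \<forall>i<n. kconv s (\<phi> i) \<and> kconv s (v i) \<and> kconv s (w i)) (at_right 0)"
  proof -
    have "eventually (\<lambda>s. \<forall>i<n. kconv s (\<phi> i)) (at_right 0)"
      "eventually (\<lambda>s. \<forall>i<n. kconv s (v i)) (at_right 0)"
      "eventually (\<lambda>s. \<forall>i<n. kconv s (w i)) (at_right 0)"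
      using phi pv pw by (auto intro!: fin)
    then show ?thesis by eventually_elim auto
  qed
  moreover have "eventually (\<lambda>s. kconv s l1 \<and> kconv s l2 \<and> kconv s c \<and> kconv s d) (at_right 0)"
    using eventually_kconv[OF l(1)] eventually_kconv[OF l(2)] eventually_kconv[OF pc] eventually_kconv[OF pd]
    by eventually_elim auto
  moreover note kpos_keval[OF l(1,3)] kpos_keval[OF l(2,4)] eventually_at_right_less[of "0::real"] neg
  ultimately have ev: "eventually (\<lambda>s.
      (\<forall>i<n. keval s c * keval s (v i) + keval s d * keval s (w i) = 0) \<and>
      (\<forall>i<n. keval s (kadd (kmul c (v i)) (kmul d (w i))) =
        keval s c * keval s (v i) + keval s d * keval s (w i)) \<and>
      (keval s d = 0 \<longrightarrow> (\<forall>i<n. keval s (v i) = 0))) (at_right 0)"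
  proof eventually_elim
    case (elim s)
    have ec: "keval s c = (\<Sum>j<n. keval s (\<phi> j) * keval s (w j))"
      using elim phi pw by (simp add: c_def keval_ksum kconv_kmul keval_kmul)
    have ed: "keval s d = - (\<Sum>j<n. keval s (\<phi> j) * keval s (v j))"
      using elim phi pv by (simp add: d_def keval_kscale keval_ksum kconv_kmul keval_kmul)
    have ev: "(\<Sum>j<n. keval s (H i j) * keval s (v j)) = keval s l1 * keval s (v i)" if "i < n" for i
    proof -
      have "keval s (ksum n (\<lambda>j. kmul (H i j) (v j))) = keval s (kmul l1 (v i))"
        using eig(1) that by (simp add: keigen_def)
      then show ?thesis using elim that H pv l by (simp add: keval_ksum kconv_kmul keval_kmul)
    qed
    have ew: "(\<Sum>j<n. keval s (H i j) * keval s (w j)) = keval s l2 * keval s (w i)" if "i < n" for i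
    proof -
      have "keval s (ksum n (\<lambda>j. kmul (H i j) (w j))) = keval s (kmul l2 (w i))"
        using eig(2) that by (simp add: keigen_def)
      then show ?thesis using elim that H pw l by (simp add: keval_ksum kconv_kmul keval_kmul)
    qed
    show ?case
    proof (intro conjI allI impI)
      fix i assume "i < n"
      show "keval s c * keval s (v i) + keval s d * keval s (w i) = 0"
        unfolding ec ed
        by (rule positive_eigenvectors_dependent[where A = "\<lambda>i j. keval s (H i j)"
              and ?l1.0 = "keval s l1" and ?l2.0 = "keval s l2"])
          (use ev ew elim sym \<open>i < n\<close> in auto)
      show "keval s (kadd (kmul c (v i)) (kmul d (w i))) =
          keval s c * keval s (v i) + keval s d * keval s (w i)"
        using elim \<open>i < n\<close> pc pd pv pw by (simp add: keval_kadd kconv_kmul keval_kmul)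
      \<comment> \<open>Up to sign, \<open>d\<close> is the pairing of \<open>\<phi>\<close> with
        \<open>v\<close>.\<close>
      assume "keval s d = 0"
      then show "keval s (v i) = 0"
        using ev ed elim \<open>i < n\<close>
        by (intro eigenvector_in_kernel_zero[where A = "\<lambda>i j. keval s (H i j)"
              and \<phi> = "\<lambda>j. keval s (\<phi> j)" and v = "\<lambda>i. keval s (v i)"]) auto
    qed
  qed
  have "kadd (kmul c (v i)) (kmul d (w i)) = kzero" if "i < n" for i
  proof (rule keval_eventually_0_imp_kzero)
    show "puiseux (kadd (kmul c (v i)) (kmul d (w i)))"
      using that by (intro puiseux_kadd puiseux_kmul pc pd pv pw)
    show "eventually (\<lambda>s. keval s (kadd (kmul c (v i)) (kmul d (w i))) = 0) (at_right 0)"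
      using ev by eventually_elim (use that in auto)
  qed
  then have "d = kzero" using indep pc pd by (auto simp: klin_indep_def)
  have v0: "v i = kzero" if "i < n" for i
  proof (rule keval_eventually_0_imp_kzero)
    show "eventually (\<lambda>s. keval s (v i) = 0) (at_right 0)"
      using ev by eventually_elim (use that \<open>d = kzero\<close> keval_kzero in auto)
  qed (use that pv in auto)
  \<comment> \<open>The constant series 1: with \<open>v\<close> zero, the coefficients 1 and 0 form
    a nontrivial relation.\<close>
  define one :: "real \<Rightarrow> real" where "one = (\<lambda>r. if r = 0 then 1 else 0)"
  have "puiseux one" by (rule puiseux_finite_support) (simp add: one_def)
  moreover have "kadd (kmul one (v i)) (kmul kzero (w i)) = kzero" if "i < n" for i
    by (simp add: v0[OF that] kadd_def kmul_def) (simp add: kzero_def)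
  ultimately have "one = kzero"
    using indep puiseux_kzero unfolding klin_indep_def by blast
  then have "one 0 = kzero 0" by simp
  then show False by (simp add: one_def kzero_def)
qed

section \<open>The Lorentzian lift of a valuated matroid\<close>

text \<open>The power of \<open>t\<close> with exponent \<open>x\<close>. An infinite exponent
  equals no real \<open>r\<close>, so it yields the zero series.\<close>

definition kmonom :: "ereal \<Rightarrow> real \<Rightarrow> real" where
  "kmonom x = (\<lambda>r. if ereal r = x then 1 else 0)"

lemma kmonom_infinity: "kmonom \<infinity> = kzero"
  by (simp add: kmonom_def kzero_def)

lemma kmonom_support: "{r. kmonom x r \<noteq> 0} \<subseteq> {real_of_ereal x}"
  by (auto simp: kmonom_def)

lemma puiseux_kmonom: "puiseux (kmonom x)"
  by (rule puiseux_finite_support) (rule finite_subset[OF kmonom_support], simp)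

lemma kmonom_eq_kzero_iff:
  assumes "x \<noteq> -\<infinity>"
  shows "kmonom x = kzero \<longleftrightarrow> x = \<infinity>"
proof
  assume *: "kmonom x = kzero"
  then have "kmonom x (real_of_ereal x) = 0" by (simp add: kzero_def)
  with assms show "x = \<infinity>" by (cases x) (auto simp: kmonom_def)
qed (simp add: kmonom_infinity)

lemma kval_kmonom:
  assumes "x \<noteq> -\<infinity>"
  shows "kval (kmonom x) = x"
proof (cases x)
  case (real r)
  have "(LEAST q. kmonom x q \<noteq> 0) = r"
    by (rule Least_equality) (auto simp: kmonom_def real split: if_splits)
  then show ?thesis using kmonom_eq_kzero_iff[OF assms] real by (simp add: kval_def)
qed (use assms in \<open>simp_all add: kval_def kmonom_infinity\<close>)

lemma knonneg_kmonom: "knonneg (kmonom x)"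
proof (cases x)
  case (real r)
  then have "kpos (kmonom x)" by (auto simp: kpos_def kmonom_def intro!: exI[of _ r])
  then show ?thesis by (simp add: knonneg_def)
qed (simp_all add: knonneg_def kmonom_def kzero_def)

lemma keval_kmonom: "keval s (kmonom x) = (if \<bar>x\<bar> = \<infinity> then 0 else s powr real_of_ereal x)"
proof (cases x)
  case (real q)
  have "keval s (kmonom x) = (\<Sum>\<^sub>\<infinity>r\<in>{q}. kmonom x r * s powr r)"
    unfolding keval_def by (rule infsum_cong_neutral) (auto simp: kmonom_def real)
  then show ?thesis by (simp add: kmonom_def real)
qed (simp_all add: keval_def kmonom_def)

lemma keval_kmonom_add:
  assumes "x \<noteq> -\<infinity>" "y \<noteq> -\<infinity>"
  shows "keval s (kmonom (x + y)) = keval s (kmonom x) * keval s (kmonom y)"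
  using assms by (cases x; cases y) (simp_all add: keval_kmonom powr_add)

text \<open>Powers of a base below 1 decrease in the exponent. Tropical inequalities between sums
  thereby become reversed inequalities between real products.\<close>

lemma keval_kmonom_antimono:
  assumes "0 < s" "s < 1" "x \<noteq> -\<infinity>" "x \<le> y"
  shows "keval s (kmonom y) \<le> keval s (kmonom x)"
  using assms by (cases x; cases y) (auto simp: keval_kmonom intro!: powr_mono')

section \<open>Consequences of the exchange property\<close>

lemma M_convex_fun_exchange:
  assumes "M_convex_fun n \<mu>" "\<mu> \<alpha> \<noteq> \<infinity>" "\<mu> \<beta> \<noteq> \<infinity>" "i < n" "\<beta> i < \<alpha> i"
  obtains j where "j < n" "\<alpha> j < \<beta> j" "\<mu> (exch \<alpha> i j) \<noteq> \<infinity>" "\<mu> (exch \<beta> j i) \<noteq> \<infinity>"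
    "\<mu> (exch \<alpha> i j) + \<mu> (exch \<beta> j i) \<le> \<mu> \<alpha> + \<mu> \<beta>"
proof -
  obtain j where j: "j < n" "\<alpha> j < \<beta> j" "\<mu> (exch \<alpha> i j) + \<mu> (exch \<beta> j i) \<le> \<mu> \<alpha> + \<mu> \<beta>"
    using assms unfolding M_convex_fun_def by blast
  moreover have "\<mu> \<gamma> \<noteq> -\<infinity>" for \<gamma> using assms(1) by (simp add: M_convex_fun_def)
  \<comment> \<open>A finite upper bound on the exchanged sum makes both exchanged values
    finite.\<close>
  moreover have "\<mu> \<alpha> + \<mu> \<beta> \<noteq> \<infinity>" using assms(2,3) by simp
  ultimately have "\<mu> (exch \<alpha> i j) + \<mu> (exch \<beta> j i) \<noteq> \<infinity>" by auto
  with j that show thesis by simp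
qed

lemma deg_exch:
  assumes "i < n" "j < n" "i \<noteq> j" "0 < \<beta> j"
  shows "deg n (exch \<beta> j i) = deg n \<beta>"
proof -
  have split: "deg n \<gamma> = \<gamma> i + (\<gamma> j + (\<Sum>l\<in>{..<n} - {i} - {j}. \<gamma> l))" for \<gamma>
    using assms by (simp add: deg_def sum.remove[of "{..<n}" i] sum.remove[of "{..<n} - {i}" j])
  have "(\<Sum>l\<in>{..<n} - {i} - {j}. exch \<beta> j i l) = (\<Sum>l\<in>{..<n} - {i} - {j}. \<beta> l)"
    by (rule sum.cong) (auto simp: exch_def)
  then show ?thesis using assms by (simp add: split) (simp add: exch_def)
qed

text \<open>Induction on the excess of \<open>\<alpha>\<close> over \<open>\<beta>\<close>: an
  exchange moves \<open>\<beta>\<close> towards \<open>\<alpha>\<close> without changing its degree,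
  until \<open>\<alpha> \<le> \<beta>\<close> holds coordinatewise. Used in both directions, this
  makes the lift homogeneous.\<close>

lemma M_convex_fun_deg_le:
  assumes "M_convex_fun n \<mu>" "\<mu> \<alpha> \<noteq> \<infinity>" "\<mu> \<beta> \<noteq> \<infinity>"
  shows "deg n \<alpha> \<le> deg n \<beta>"
  using assms(3)
proof (induction "\<Sum>i<n. \<alpha> i - \<beta> i" arbitrary: \<beta> rule: less_induct)
  case less
  show ?case
  proof (cases "\<forall>i<n. \<alpha> i \<le> \<beta> i")
    case True
    then show ?thesis unfolding deg_def by (intro sum_mono) auto
  next
    case False
    then obtain i where i: "i < n" "\<beta> i < \<alpha> i" by (auto simp: not_le)
    obtain j where j: "j < n" "\<alpha> j < \<beta> j" "\<mu> (exch \<beta> j i) \<noteq> \<infinity>"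
      using M_convex_fun_exchange[OF assms(1,2) less.prems i] by metis
    have "i \<noteq> j" using i j by auto
    have "(\<Sum>l<n. \<alpha> l - exch \<beta> j i l) < (\<Sum>l<n. \<alpha> l - \<beta> l)"
    proof (rule sum_strict_mono_ex1)
      \<comment> \<open>At \<open>j\<close> the truncated difference stays 0 because
        \<open>\<alpha> j < \<beta> j\<close>; at \<open>i\<close> it drops by one.\<close>
      show "\<forall>l\<in>{..<n}. \<alpha> l - exch \<beta> j i l \<le> \<alpha> l - \<beta> l"
        using j(2) by (auto simp: exch_def)
      show "\<exists>l\<in>{..<n}. \<alpha> l - exch \<beta> j i l < \<alpha> l - \<beta> l"
        using i \<open>i \<noteq> j\<close> by (intro bexI[of _ i]) (auto simp: exch_def)
    qed simp
    then have "deg n \<alpha> \<le> deg n (exch \<beta> j i)" using j(3) by (rule less.hyps)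
    then show ?thesis using deg_exch[of i n j \<beta>] i j \<open>i \<noteq> j\<close> by simp
  qed
qed

section \<open>Hessians of the lift\<close>

definition add_pair :: "(nat \<Rightarrow> nat) \<Rightarrow> nat \<Rightarrow> nat \<Rightarrow> nat \<Rightarrow> nat" where
  "add_pair \<alpha> i j = (\<lambda>l. \<alpha> l + unitv i l + unitv j l)"

lemma add_pair_commute: "add_pair \<alpha> i j = add_pair \<alpha> j i"
  by (auto simp: add_pair_def)

text \<open>Exchange at index \<open>i\<close> between \<open>add_pair \<alpha> i j\<close> and
  \<open>add_pair \<alpha> k l\<close>: the incoming index can only be \<open>k\<close> or
  \<open>l\<close>, and these two outcomes are the two alternatives.\<close>

lemma M_convex_fun_four_point:
  fixes \<alpha> :: "nat \<Rightarrow> nat"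
  assumes mc: "M_convex_fun n \<mu>" and n: "i < n" "j < n" "k < n" "l < n"
    and dist: "distinct [i, j, k, l]"
  defines "m \<equiv> \<lambda>i j. \<mu> (add_pair \<alpha> i j)"
  shows "m i k + m j l \<le> m i j + m k l \<or> m i l + m j k \<le> m i j + m k l"
proof (cases "m i j = \<infinity> \<or> m k l = \<infinity>")
  case True
  then have "m i j + m k l = \<infinity>" by auto
  then show ?thesis by (simp only: ereal_less_eq simp_thms)
next
  case False
  have "add_pair \<alpha> k l i < add_pair \<alpha> i j i" using dist by (auto simp: add_pair_def unitv_def)
  then obtain q where q: "add_pair \<alpha> i j q < add_pair \<alpha> k l q"
    "\<mu> (exch (add_pair \<alpha> i j) i q) + \<mu> (exch (add_pair \<alpha> k l) q i) \<le> m i j + m k l"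
    using M_convex_fun_exchange[OF mc, of "add_pair \<alpha> i j" "add_pair \<alpha> k l" i] False n(1)
    unfolding m_def by metis
  then have "q = k \<or> q = l" by (auto simp: add_pair_def unitv_def split: if_splits)
  moreover have "exch (add_pair \<alpha> i j) i k = add_pair \<alpha> j k" "exch (add_pair \<alpha> k l) k i = add_pair \<alpha> i l"
    "exch (add_pair \<alpha> i j) i l = add_pair \<alpha> j l" "exch (add_pair \<alpha> k l) l i = add_pair \<alpha> i k"
    using dist by (auto simp: exch_def add_pair_def unitv_def)
  ultimately show ?thesis using q(2) unfolding m_def by (auto simp: add.commute)
qed

text \<open>Finite values occur only at 0/1 vectors, where all factorials are 1; elsewhere the
  coefficient is zero and absorbs the factor.\<close>

lemma hess_kmonom:
  assumes "valuated_matroid n \<mu>"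
  shows "hess n (\<lambda>\<alpha>. kmonom (\<mu> \<alpha>)) \<alpha> i j = kmonom (\<mu> (add_pair \<alpha> i j))"
proof (cases "\<mu> (add_pair \<alpha> i j) = \<infinity>")
  case True
  then show ?thesis
    by (simp add: hess_def add_pair_def[symmetric] kmonom_infinity) (simp add: kscale_def kzero_def)
next
  case False
  then have "\<forall>l. add_pair \<alpha> i j l \<le> 1" using assms by (simp add: valuated_matroid_def)
  then have "fact (add_pair \<alpha> i j l) = (1 :: real)" for l
    by (metis One_nat_def fact_0 fact_Suc_0 le_SucE le_zero_eq)
  then have "mfact n (add_pair \<alpha> i j) = 1" by (simp add: mfact_def)
  then show ?thesis by (simp add: hess_def add_pair_def[symmetric] kscale_def)
qed

text \<open>A row with a nonzero entry serves as the functional \<open>\<phi>\<close>; its series do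
  not depend on the point \<open>s\<close> of evaluation, as the transfer to Puiseux series
  demands.\<close>

lemma at_most_one_pos_eig_hess_kmonom:
  assumes vm: "valuated_matroid n \<mu>"
  shows "at_most_one_pos_eig n (hess n (\<lambda>\<alpha>. kmonom (\<mu> \<alpha>)) \<alpha>)"
proof -
  define m where "m i j = \<mu> (add_pair \<alpha> i j)" for i j
  have mc: "M_convex_fun n \<mu>" using vm by (simp add: valuated_matroid_def)
  have fin: "m i j \<noteq> -\<infinity>" for i j using mc by (simp add: M_convex_fun_def m_def)
  have sym: "m i j = m j i" for i j by (simp add: m_def add_pair_commute)
  have diag: "m i i = \<infinity>" for i
  proof (rule ccontr)
    assume "m i i \<noteq> \<infinity>"
    \<comment> \<open>The entry at \<open>i\<close> is at least 2, so the vector lies outside the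
      finite domain.\<close>
    then have "add_pair \<alpha> i i i \<le> 1" using vm by (simp add: valuated_matroid_def m_def)
    then show False by (simp add: add_pair_def unitv_def)
  qed
  have H: "hess n (\<lambda>\<alpha>. kmonom (\<mu> \<alpha>)) \<alpha> = (\<lambda>i j. kmonom (m i j))"
    by (intro ext) (simp add: hess_kmonom[OF vm] m_def)
  obtain \<phi> where phi: "\<And>j. puiseux (\<phi> j)"
    and neg: "\<And>s u. \<lbrakk>0 < s; s < 1; (\<Sum>j<n. keval s (\<phi> j) * u j) = 0\<rbrakk> \<Longrightarrow>
      (\<Sum>i<n. \<Sum>j<n. keval s (kmonom (m i j)) * (u i * u j)) \<le> 0"
  proof (cases "\<exists>p<n. \<exists>q<n. m p q \<noteq> \<infinity>")
    case False
    then have "(\<Sum>i<n. \<Sum>j<n. keval s (kmonom (m i j)) * (u i * u j)) \<le> 0" for s u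
      by (simp add: keval_kmonom)
    \<comment> \<open>The Hessian is zero here, so its form is nonpositive everywhere and the zero
      functional will do.\<close>
    then show thesis using that[of "\<lambda>_. kzero"] puiseux_kzero by blast
  next
    case True
    then obtain p q where pq: "p < n" "q < n" "m p q \<noteq> \<infinity>" by blast
    show thesis
    proof (rule that)
      show "puiseux (kmonom (m p j))" for j by (rule puiseux_kmonom)
      fix s :: real and u
      assume s: "0 < s" "s < 1" and row: "(\<Sum>j<n. keval s (kmonom (m p j)) * u j) = 0"
      show "(\<Sum>i<n. \<Sum>j<n. keval s (kmonom (m i j)) * (u i * u j)) \<le> 0"
      proof (rule four_point_nonpos_on_row_kernel)
        show "keval s (kmonom (m i j)) * keval s (kmonom (m k l)) \<le>
            max (keval s (kmonom (m i k)) * keval s (kmonom (m j l)))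
              (keval s (kmonom (m i l)) * keval s (kmonom (m j k)))"
          if "i \<in> {..<n}" "j \<in> {..<n}" "k \<in> {..<n}" "l \<in> {..<n}" "distinct [i, j, k, l]" for i j k l
        proof -
          have "m i k + m j l \<le> m i j + m k l \<or> m i l + m j k \<le> m i j + m k l"
            unfolding m_def using that by (intro M_convex_fun_four_point[OF mc]) auto
          then have "keval s (kmonom (m i j + m k l)) \<le> keval s (kmonom (m i k + m j l)) \<or>
              keval s (kmonom (m i j + m k l)) \<le> keval s (kmonom (m i l + m j k))"
            using keval_kmonom_antimono[OF s] fin by (metis ereal_MInfty_eq_plus)
          then show ?thesis by (simp only: keval_kmonom_add[OF fin fin] le_max_iff_disj)
        qed
        show "keval s (kmonom (m p q)) \<noteq> 0"
          using pq(3) fin[of p q] s by (auto simp: keval_kmonom)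
      qed (use pq row sym diag in \<open>auto simp: keval_kmonom\<close>)
    qed
  qed
  show ?thesis
    unfolding H
  proof (rule at_most_one_pos_eigI[OF puiseux_kmonom _ phi])
    show "kmonom (m i j) = kmonom (m j i)" for i j by (simp add: sym[of i j])
    have "eventually (\<lambda>s::real. 0 < s \<and> s < 1) (at_right 0)"
      by (auto simp: eventually_at_right_field intro!: exI[of _ 1])
    then show "eventually (\<lambda>s. \<forall>u. (\<Sum>j<n. keval s (\<phi> j) * u j) = 0 \<longrightarrow>
        (\<Sum>i<n. \<Sum>j<n. keval s (kmonom (m i j)) * (u i * u j)) \<le> 0) (at_right 0)"
      by eventually_elim (use neg in blast)
  qed
qed

section \<open>Support of the lift and the equivalence\<close>

lemma valuated_matroid_finite_domain:
  assumes "valuated_matroid n \<mu>"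
  shows "{\<alpha>. \<mu> \<alpha> \<noteq> \<infinity>} = ind ` underlying n \<mu>"
proof (intro equalityI subsetI)
  fix \<alpha> assume \<alpha>: "\<alpha> \<in> {\<alpha>. \<mu> \<alpha> \<noteq> \<infinity>}"
  then have le: "\<alpha> j \<le> 1" and "in_Nn n \<alpha>" for j
    using assms by (auto simp: valuated_matroid_def M_convex_fun_def)
  have "\<alpha> j = ind {j. \<alpha> j = 1} j" for j using le[of j] by (simp add: ind_def)
  then have "\<alpha> = ind {j. \<alpha> j = 1}" by blast
  moreover have "{j. \<alpha> j = 1} \<subseteq> {..<n}"
    using \<open>in_Nn n \<alpha>\<close> by (force simp: in_Nn_def not_le[symmetric])
  ultimately show "\<alpha> \<in> ind ` underlying n \<mu>"
    using \<alpha> unfolding underlying_def by (intro image_eqI[of _ _ "{j. \<alpha> j = 1}"]) auto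
qed (auto simp: underlying_def)

lemma poly_supp_kmonom:
  assumes "valuated_matroid n \<mu>"
  shows "poly_supp (\<lambda>\<alpha>. kmonom (\<mu> \<alpha>)) = {\<alpha>. \<mu> \<alpha> \<noteq> \<infinity>}"
  using assms by (simp add: poly_supp_def kmonom_eq_kzero_iff valuated_matroid_def M_convex_fun_def)

lemma lorentzian_kmonom:
  assumes vm: "valuated_matroid n \<mu>"
  shows "lorentzian n (\<lambda>\<alpha>. kmonom (\<mu> \<alpha>))"
proof -
  have mc: "M_convex_fun n \<mu>" using vm by (simp add: valuated_matroid_def)
  note supp = poly_supp_kmonom[OF vm]
  have "underlying n \<mu> \<subseteq> Pow {..<n}" by (auto simp: underlying_def)
  then have "finite {\<alpha>. \<mu> \<alpha> \<noteq> \<infinity>}"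
    unfolding valuated_matroid_finite_domain[OF vm] by (intro finite_imageI) (simp add: finite_subset)
  then have "kpoly n (\<lambda>\<alpha>. kmonom (\<mu> \<alpha>))"
    using supp mc unfolding kpoly_def poly_supp_def M_convex_fun_def
    by (auto simp: puiseux_kmonom)
  moreover obtain \<gamma> where "\<mu> \<gamma> \<noteq> \<infinity>" using vm by (auto simp: valuated_matroid_def)
  then have "deg n \<alpha> = deg n \<gamma>" if "\<mu> \<alpha> \<noteq> \<infinity>" for \<alpha>
    \<comment> \<open>The degree comparison is applied both ways round against one fixed point
      \<open>\<gamma>\<close> of the domain.\<close>
    using M_convex_fun_deg_le[OF mc] that by (metis order_antisym)
  moreover have "M_convex_set n {\<alpha>. \<mu> \<alpha> \<noteq> \<infinity>}"
    unfolding M_convex_set_def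
  proof (intro ballI allI impI)
    fix \<alpha> \<beta> i
    assume "\<alpha> \<in> {\<alpha>. \<mu> \<alpha> \<noteq> \<infinity>}" "\<beta> \<in> {\<alpha>. \<mu> \<alpha> \<noteq> \<infinity>}" "i < n" "\<beta> i < \<alpha> i"
    then obtain j where "j < n" "\<alpha> j < \<beta> j" "\<mu> (exch \<alpha> i j) \<noteq> \<infinity>" "\<mu> (exch \<beta> j i) \<noteq> \<infinity>"
      using M_convex_fun_exchange[OF mc, of \<alpha> \<beta> i] by auto
    then show "\<exists>j<n. \<alpha> j < \<beta> j \<and> exch \<alpha> i j \<in> {\<alpha>. \<mu> \<alpha> \<noteq> \<infinity>} \<and> exch \<beta> j i \<in> {\<alpha>. \<mu> \<alpha> \<noteq> \<infinity>}"
      by blast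
  qed
  ultimately show ?thesis
    unfolding lorentzian_def supp
    by (auto simp: at_most_one_pos_eig_hess_kmonom[OF vm] knonneg_kmonom intro!: exI[of _ "deg n \<gamma>"])
qed

theorem theorem4p6:
  fixes n k :: nat and \<mu> :: "nat \<Rightarrow> (nat \<Rightarrow> nat) \<Rightarrow> ereal"
  assumes "\<forall>i<k. valuated_matroid n (\<mu> i)"
    and "flag_matroid n k (\<lambda>i. underlying n (\<mu> i))"
  shows "\<mu> \<in> FlDr n k (\<lambda>i. underlying n (\<mu> i)) \<longleftrightarrow>
    ((\<exists>f :: nat \<Rightarrow> (nat \<Rightarrow> nat) \<Rightarrow> real \<Rightarrow> real.
        \<forall>i<k. lorentzian n (f i) \<and> poly_supp (f i) = ind ` underlying n (\<mu> i) \<and>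
              trop (f i) = \<mu> i)
     \<and> valuated_flag_matroid n k \<mu>)"
proof -
  have not_MInf: "\<mu> i \<alpha> \<noteq> -\<infinity>" if "i < k" for i \<alpha>
    using assms(1) that by (simp add: valuated_matroid_def M_convex_fun_def)
  have "lorentzian n (\<lambda>\<alpha>. kmonom (\<mu> i \<alpha>)) \<and>
      poly_supp (\<lambda>\<alpha>. kmonom (\<mu> i \<alpha>)) = ind ` underlying n (\<mu> i) \<and>
      trop (\<lambda>\<alpha>. kmonom (\<mu> i \<alpha>)) = \<mu> i" if "i < k" for i
  proof -
    have vm: "valuated_matroid n (\<mu> i)" using assms(1) that by blast
    have "trop (\<lambda>\<alpha>. kmonom (\<mu> i \<alpha>)) = \<mu> i"
      using not_MInf[OF that] by (simp add: trop_def kval_kmonom)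
    then show ?thesis
      using lorentzian_kmonom[OF vm] poly_supp_kmonom[OF vm] valuated_matroid_finite_domain[OF vm] by simp
  qed
  then have lift: "\<exists>f :: nat \<Rightarrow> (nat \<Rightarrow> nat) \<Rightarrow> real \<Rightarrow> real.
      \<forall>i<k. lorentzian n (f i) \<and> poly_supp (f i) = ind ` underlying n (\<mu> i) \<and> trop (f i) = \<mu> i"
    by (intro exI[of _ "\<lambda>i \<alpha>. kmonom (\<mu> i \<alpha>)"]) blast
  \<comment> \<open>Finite values sit at indicator vectors of bases, as membership in the flag
    Dressian asks.\<close>
  have "\<exists>B. \<alpha> = ind B" if "i < k" "\<mu> i \<alpha> \<noteq> \<infinity>" for i \<alpha>
    using valuated_matroid_finite_domain[of n "\<mu> i"] assms(1) that by blast
  then have "\<mu> \<in> FlDr n k (\<lambda>i. underlying n (\<mu> i)) \<longleftrightarrow> flag_relations n k \<mu>"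
    using not_MInf by (simp add: FlDr_def)
  moreover have "valuated_flag_matroid n k \<mu> \<longleftrightarrow> flag_relations n k \<mu>"
    using assms(1) by (simp add: valuated_flag_matroid_def)
  ultimately show ?thesis using lift by (simp only: simp_thms)
qed

end
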